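(* (i) Let $p$ be an odd prime and let $m,n\in\mathbb Z$ with $n\ge m+3$. Then for any complex numbers $a,b,c,d$, $$\det\left[a+b\left(\frac jp\right)+c\left(\frac kp\right)+d\left(\frac{jk}p\right)\right]_{m\le j,k\le n}=0.$$ (ii) Let $p>5$ be a prime with $p\equiv1\pmod4$. For any $\delta\in\{\pm1\}$, any $m\in\{0,1\}$ and any complex number $x$, $$\det\left[x+\left(\frac{j^2+k^2}p\right)+\delta\left(\frac{j^2-k^2}p\right)\right]_{m\le j,k\le (p-1)/2}=0.$$
   Context: $\left(\frac{\cdot}{p}\right)$ denotes the Legendre symbol modulo $p$, with $\left(\frac{a}{p}\right)=0$ when $p\mid a$. For a matrix indexed by $m\le j,k\le n$, $\det[a_{jk}]_{m\le j,k\le n}$ is its determinant. *)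

theory Defs
  imports
    "HOL-Number_Theory.Residues"
    "Jordan_Normal_Form.Determinant"
begin

text \<open>
  The determinant of the square matrix whose rows and columns are both indexed by the
  integers \<open>m, \<dots>, n\<close>. Indices of \<^const>\<open>mat\<close> start at \<open>0\<close>, hence the shift by \<open>m\<close>;
  for \<open>n < m\<close> the matrix is empty and the determinant is \<open>1\<close>.
\<close>
definition det_interval :: "int \<Rightarrow> int \<Rightarrow> (int \<Rightarrow> int \<Rightarrow> 'a :: comm_ring_1) \<Rightarrow> 'a" where
  "det_interval m n a =
     Determinant.det (mat (nat (n - m + 1)) (nat (n - m + 1))
       (\<lambda>(r, s). a (m + int r) (m + int s)))"

end

theory Submission
  imports Defs "HOL-Number_Theory.Euler_Criterion"
begin

text \<open>
  Both determinants vanish because of an explicit integer vector in the kernel.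
  In (i) the symbol takes only three values, so among any four columns two coincide.
  In (ii), for \<open>p \<equiv> 1 (mod 4)\<close> every \<open>k\<close> prime to \<open>p\<close> has a partner \<open>k'\<close> in
  \<open>1, \<dots>, (p - 1) / 2\<close> with \<open>k'\<^sup>2 \<equiv> - k\<^sup>2\<close>. Passing from \<open>k\<close> to \<open>k'\<close> exchanges the two
  symbols, so that column \<open>k\<close> minus \<open>\<delta>\<close> times column \<open>k'\<close> is the constant vector \<open>x (1 - \<delta>)\<close>,
  whatever \<open>k\<close> is; the difference of these relations for \<open>k = 1\<close> and \<open>k = 2\<close> is nontrivial
  when \<open>p > 5\<close>.
\<close>

text \<open>The kernel vector is a function \<open>v\<close> on the integers
  \<open>m, ..., n\<close> themselves, so that the shift to indices from \<open>0\<close> is dealt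
  with only here. The point \<open>k0\<close> certifies that \<open>v\<close> is nonzero.\<close>

lemma det_interval_eq_0I:
  fixes a :: "int \<Rightarrow> int \<Rightarrow> 'a :: field"
  assumes k0: "k0 \<in> {m..n}" "v k0 \<noteq> 0"
    and kernel: "\<And>j. j \<in> {m..n} \<Longrightarrow> (\<Sum>k = m..n. a j k * v k) = 0"
  shows "det_interval m n a = 0"
proof -
  define N where "N = nat (n - m + 1)"
  define A where "A = mat N N (\<lambda>(r, s). a (m + int r) (m + int s))"
  define w where "w = vec N (\<lambda>s. v (m + int s))"
  have A: "A \<in> carrier_mat N N" by (simp add: A_def)
  have w: "w \<in> carrier_vec N" by (simp add: w_def)
  have "w \<noteq> 0\<^sub>v N"
  proof
    assume *: "w = 0\<^sub>v N"
    have "nat (k0 - m) < N" using k0 by (auto simp: N_def)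
    moreover from this * have "w $ nat (k0 - m) = 0" by simp
    ultimately show False using k0 by (simp add: w_def)
  qed
  moreover have "A *\<^sub>v w = 0\<^sub>v N"
  proof (rule eq_vecI)
    fix r assume "r < dim_vec (0\<^sub>v N :: 'a vec)"
    hence r: "r < N" by simp
    have "(A *\<^sub>v w) $ r = (\<Sum>s = 0..<N. a (m + int r) (m + int s) * v (m + int s))"
      using r by (simp add: A_def w_def scalar_prod_def)
    also have "\<dots> = (\<Sum>k = m..n. a (m + int r) k * v k)"
      by (rule sum.reindex_bij_witness[of _ "\<lambda>k. nat (k - m)" "\<lambda>s. m + int s"])
        (auto simp: N_def)
    also have "\<dots> = 0" using r by (intro kernel) (auto simp: N_def)
    finally show "(A *\<^sub>v w) $ r = 0\<^sub>v N $ r" using r by simp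
  qed (simp add: A_def)
  ultimately have "Determinant.det A = 0"
    using det_0_iff_vec_prod_zero_field[OF A] w by blast
  thus ?thesis by (simp add: det_interval_def A_def N_def)
qed

lemma Legendre_cases: "Legendre a p = 0 \<or> Legendre a p = 1 \<or> Legendre a p = -1"
  by (simp add: Legendre_def)

lemma Legendre_cong:
  assumes "[a = b] (mod p)"
  shows "Legendre a p = Legendre b p"
proof -
  have "[a = 0] (mod p) \<longleftrightarrow> [b = 0] (mod p)" and "QuadRes p a \<longleftrightarrow> QuadRes p b"
    using assms unfolding QuadRes_def by (meson cong_sym cong_trans)+
  thus ?thesis by (simp add: Legendre_def)
qed

lemma euler_criterion_int:
  fixes p :: int
  assumes "prime p" "2 < p"
  shows "[Legendre a p = a ^ ((nat p - 1) div 2)] (mod p)"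
proof -
  have "int (nat p) = p" using assms by simp
  moreover from this have "prime (nat p)" using assms(1) prime_nat_int_transfer by metis
  ultimately show ?thesis using euler_criterion[of "nat p" a] assms(2) by simp
qed

text \<open>By Euler's criterion both sides are congruent modulo \<open>p\<close> to the same power
  of \<open>a * b\<close>. All symbols lie in {0, 1, -1}, so the sides differ by at most 2, which is
  less than \<open>p\<close>.\<close>

lemma Legendre_mult:
  fixes p :: int
  assumes "prime p" "2 < p"
  shows "Legendre (a * b) p = Legendre a p * Legendre b p"
proof -
  have "[Legendre a p * Legendre b p = (a * b) ^ ((nat p - 1) div 2)] (mod p)"
    using cong_mult[OF euler_criterion_int[OF assms] euler_criterion_int[OF assms]]
    by (simp add: power_mult_distrib)
  hence "[Legendre (a * b) p = Legendre a p * Legendre b p] (mod p)"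
    using euler_criterion_int[OF assms, of "a * b"] cong_sym cong_trans by blast
  hence "p dvd Legendre (a * b) p - Legendre a p * Legendre b p"
    by (simp add: cong_iff_dvd_diff)
  moreover have "\<bar>Legendre (a * b) p - Legendre a p * Legendre b p\<bar> < p"
    using Legendre_cases[of "a * b" p] Legendre_cases[of a p] Legendre_cases[of b p] \<open>2 < p\<close>
    by auto
  ultimately show ?thesis using zdvd_not_zless[of _ p]
    by (metis abs_dvd_iff dvd_abs_iff eq_iff_diff_eq_0 zero_less_abs_iff)
qed

lemma QuadRes_minus_one:
  fixes p :: int
  assumes "prime p" "2 < p" "[p = 1] (mod 4)"
  shows "QuadRes p (-1)"
proof -
  have "p mod 4 = 1" using assms(3) by (simp add: cong_def)
  then obtain q where "p = 4 * q + 1" by (metis mult_div_mod_eq)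
  moreover from this have "q \<ge> 0" using assms by linarith
  \<comment> \<open>The exponent in Euler's criterion is even, so the power of \<open>-1\<close> is
    \<open>1\<close>.\<close>
  ultimately have "(nat p - 1) div 2 = 2 * nat q" by (simp add: nat_mult_distrib nat_add_distrib)
  hence "[Legendre (-1) p = 1] (mod p)"
    using euler_criterion_int[OF assms(1,2), of "-1"] by simp
  \<comment> \<open>These two facts exclude the values \<open>-1\<close> and \<open>0\<close>, whose
    differences from \<open>1\<close> are \<open>-2\<close> and \<open>-1\<close>.\<close>
  moreover have "\<not> p dvd - 2" using \<open>2 < p\<close> zdvd_not_zless[of 2 p] by simp
  moreover have "\<not> p dvd - 1" using \<open>2 < p\<close> by simp
  ultimately have "Legendre (-1) p = 1"
    using Legendre_cases[of "-1" p] by (auto simp: cong_iff_dvd_diff)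
  thus ?thesis by (auto simp: Legendre_def split: if_splits)
qed

text \<open>Multiplying \<open>k\<close> by a square root \<open>y\<close> of \<open>-1\<close>
  negates its square modulo \<open>p\<close>. Replacing the residue \<open>r\<close> by
  \<open>p - r\<close> keeps the square and moves an upper residue into the lower half.\<close>

lemma ex_neg_square:
  fixes p k :: int
  assumes p: "prime p" "2 < p" "[p = 1] (mod 4)" and k: "\<not> p dvd k"
  obtains k' where "k' \<in> {1..(p - 1) div 2}" "[k'\<^sup>2 = - k\<^sup>2] (mod p)"
proof -
  obtain y where y: "[y\<^sup>2 = -1] (mod p)" using QuadRes_minus_one[OF p] by (auto simp: QuadRes_def)
  have sq: "[(y * k)\<^sup>2 = - k\<^sup>2] (mod p)"
    using cong_mult[OF y cong_refl[of "k\<^sup>2"]] by (simp add: power_mult_distrib)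
  have "\<not> p dvd y"
  proof
    assume "p dvd y"
    hence "p dvd y\<^sup>2" by (simp add: power2_eq_square)
    hence "p dvd -1" using y cong_dvd_iff by blast
    thus False using p by simp
  qed
  \<comment> \<open>This keeps the representative away from \<open>0\<close>, so that the range can
    start at \<open>1\<close>.\<close>
  hence "\<not> p dvd y * k" using k p by (simp add: prime_dvd_mult_iff)
  define r where "r = (y * k) mod p"
  have "r \<noteq> 0" using \<open>\<not> p dvd y * k\<close> by (simp add: r_def dvd_eq_mod_eq_0)
  moreover have "0 \<le> r" "r < p" using p by (simp_all add: r_def)
  ultimately have r: "0 < r" "r < p" by linarith+
  have rc: "[r = y * k] (mod p)" by (simp add: r_def cong_def)
  have r2: "[r\<^sup>2 = - k\<^sup>2] (mod p)" using cong_trans[OF cong_pow[OF rc] sq] .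
  have "[p - r = - r] (mod p)" by (simp add: cong_iff_dvd_diff)
  from cong_pow[OF this, of 2] have "[(p - r)\<^sup>2 = r\<^sup>2] (mod p)" by simp
  hence pr2: "[(p - r)\<^sup>2 = - k\<^sup>2] (mod p)" using r2 by (rule cong_trans)
  have "odd p" using prime_odd_int[OF p(1,2)] .
  show thesis
  proof (cases "r \<le> (p - 1) div 2")
    case True
    thus thesis using that[of r] r r2 by simp
  next
    case False
    hence "p - r \<le> (p - 1) div 2" using \<open>odd p\<close> by presburger
    thus thesis using that[of "p - r"] r pr2 by simp
  qed
qed

lemma det_interval_affine_Legendre:
  fixes p m n :: int and a b c d :: complex
  assumes p: "prime p" "odd p" and n: "n \<ge> m + 3"
  shows "det_interval m n (\<lambda>j k. a + b * of_int (Legendre j p) + c * of_int (Legendre k p)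
           + d * of_int (Legendre (j * k) p)) = 0"
proof -
  have "2 < p" using p prime_ge_2_int[of p] by (cases "p = 2") auto
  let ?L = "\<lambda>k. Legendre k p"
  have "\<not> inj_on ?L {m..m + 3}"
  proof
    assume "inj_on ?L {m..m + 3}"
    moreover have "?L ` {m..m + 3} \<subseteq> {0, 1, -1}" using Legendre_cases[of _ p] by blast
    ultimately have "card {m..m + 3} \<le> card {0, 1, -1 :: int}" by (intro card_inj_on_le) auto
    thus False by simp
  qed
  then obtain k l where kl: "k \<in> {m..m + 3}" "l \<in> {m..m + 3}" "k \<noteq> l" "?L k = ?L l"
    by (auto simp: inj_on_def)
  \<comment> \<open>A difference of two unit vectors: the product with the matrix is column
    \<open>k\<close> minus column \<open>l\<close>.\<close>
  define v :: "int \<Rightarrow> complex" where "v i = of_bool (i = k) - of_bool (i = l)" for i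
  show ?thesis
  proof (rule det_interval_eq_0I[where v = v and ?k0.0 = k])
    show "k \<in> {m..n}" using kl n by auto
    show "v k \<noteq> 0" using kl by (simp add: v_def)
    \<comment> \<open>By multiplicativity the last term is \<open>d\<close> times the symbols of
      \<open>j\<close> and \<open>i\<close>, so the entry depends on the column \<open>i\<close>
      only through \<open>?L i\<close>, and \<open>?L k = ?L l\<close> gives cancellation.\<close>
    show "(\<Sum>i = m..n. (a + b * of_int (?L j) + c * of_int (?L i) + d * of_int (?L (j * i))) * v i) = 0"
      for j
      using kl n
      by (simp add: v_def right_diff_distrib sum_subtractf Int_insert_right
          Legendre_mult[OF p(1) \<open>2 < p\<close>])
  qed
qed

lemma det_interval_Legendre_squares:
  fixes p \<delta> m :: int and x :: complex
  assumes p: "prime p" "p > 5" "[p = 1] (mod 4)" and \<delta>: "\<delta> \<in> {1, -1}" and m: "m \<in> {0, 1}"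
  shows "det_interval m ((p - 1) div 2) (\<lambda>j k. x + of_int (Legendre (j\<^sup>2 + k\<^sup>2) p)
           + of_int \<delta> * of_int (Legendre (j\<^sup>2 - k\<^sup>2) p)) = 0"
proof -
  define n where "n = (p - 1) div 2"
  define f where "f j k = x + of_int (Legendre (j\<^sup>2 + k\<^sup>2) p)
           + of_int \<delta> * of_int (Legendre (j\<^sup>2 - k\<^sup>2) p)" for j k
  have "2 < p" using p by simp
  have nd: "\<not> p dvd i" if "0 < i" "i \<le> 5" for i using zdvd_not_zless[of i p] that p by auto
  obtain k where k: "k \<in> {1..n}" "[k\<^sup>2 = - (1\<^sup>2)] (mod p)"
    unfolding n_def by (rule ex_neg_square[OF p(1) \<open>2 < p\<close> p(3) nd[of 1]]) auto
  obtain l where l: "l \<in> {1..n}" "[l\<^sup>2 = - (2\<^sup>2)] (mod p)"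
    unfolding n_def by (rule ex_neg_square[OF p(1) \<open>2 < p\<close> p(3) nd[of 2]]) auto
  \<comment> \<open>\<open>k = 1\<close> would force \<open>p\<close> to divide 1 + 1 = 2, and
    \<open>l = 1\<close> would force it to divide 1 + 4 = 5.\<close>
  have "k \<noteq> 1" using k nd[of 2] by (auto simp: cong_iff_dvd_diff)
  have "l \<noteq> 1" using l nd[of 5] by (auto simp: cong_iff_dvd_diff)
  \<comment> \<open>With A and B the symbols of the sum and the difference for \<open>i\<close>, the
    left side is x + A + \<delta>B - \<delta>(x + B + \<delta>A), and \<delta> has square 1.\<close>
  have relation: "f j i - of_int \<delta> * f j i' = x * (1 - of_int \<delta>)"
    if "[i'\<^sup>2 = - i\<^sup>2] (mod p)" for i i' j
  proof -
    have "Legendre (j\<^sup>2 + i'\<^sup>2) p = Legendre (j\<^sup>2 - i\<^sup>2) p"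
      using cong_add[OF cong_refl that, of "j\<^sup>2"] by (intro Legendre_cong) simp
    moreover have "Legendre (j\<^sup>2 - i'\<^sup>2) p = Legendre (j\<^sup>2 + i\<^sup>2) p"
      using cong_diff[OF cong_refl that, of "j\<^sup>2"] by (intro Legendre_cong) simp
    ultimately show ?thesis using \<delta> by (auto simp: f_def algebra_simps)
  qed
  \<comment> \<open>The relation for 1 and \<open>k\<close> minus the relation for 2 and
    \<open>l\<close>. Indicators add up correctly even where indices coincide; since
    \<open>k\<close> and \<open>l\<close> differ from 1, the entry at 1 is 1.\<close>
  define v :: "int \<Rightarrow> complex" where "v i = of_bool (i = 1) - of_int \<delta> * of_bool (i = k)
    - (of_bool (i = 2) - of_int \<delta> * of_bool (i = l))" for i
  have "n \<ge> 2" using p by (simp add: n_def)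
  have "det_interval m n f = 0"
  proof (rule det_interval_eq_0I[where v = v and ?k0.0 = 1])
    show "1 \<in> {m..n}" using m \<open>n \<ge> 2\<close> by auto
    show "v 1 \<noteq> 0" using \<open>k \<noteq> 1\<close> \<open>l \<noteq> 1\<close> by (simp add: v_def)
    fix j
    \<comment> \<open>All four indices are positive, so they lie in the range for
      \<open>m = 0\<close> and \<open>m = 1\<close> alike.\<close>
    have "{1, 2, k, l} \<subseteq> {m..n}" using k(1) l(1) m \<open>n \<ge> 2\<close> by auto
    have "(\<Sum>i = m..n. f j i * v i) =
      (\<Sum>i = m..n. f j i * of_bool (i = 1)) - (\<Sum>i = m..n. of_int \<delta> * f j i * of_bool (i = k))
      - ((\<Sum>i = m..n. f j i * of_bool (i = 2)) - (\<Sum>i = m..n. of_int \<delta> * f j i * of_bool (i = l)))"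
      unfolding sum_subtractf[symmetric] v_def by (intro sum.cong) (auto simp: algebra_simps)
    also have "\<dots> = (f j 1 - of_int \<delta> * f j k) - (f j 2 - of_int \<delta> * f j l)"
      using \<open>{1, 2, k, l} \<subseteq> {m..n}\<close> by (simp add: Int_insert_right)
    also have "\<dots> = 0" using relation[OF k(2)] relation[OF l(2)] by simp
    finally show "(\<Sum>i = m..n. f j i * v i) = 0" .
  qed
  thus ?thesis by (simp add: f_def[abs_def] n_def)
qed

theorem theorem1p1:
  shows "(\<forall>(p::int) (m::int) (n::int) (a::complex) (b::complex) (c::complex) (d::complex).
            prime p \<longrightarrow> odd p \<longrightarrow> n \<ge> m + 3 \<longrightarrow>
            det_interval m n (\<lambda>j k.
              a + b * of_int (Legendre j p) + c * of_int (Legendre k p)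
                + d * of_int (Legendre (j * k) p)) = 0) \<and>
         (\<forall>(p::int) (\<delta>::int) (m::int) (x::complex).
            prime p \<longrightarrow> p > 5 \<longrightarrow> [p = 1] (mod 4) \<longrightarrow> \<delta> \<in> {1, -1} \<longrightarrow> m \<in> {0, 1} \<longrightarrow>
            det_interval m ((p - 1) div 2) (\<lambda>j k.
              x + of_int (Legendre (j\<^sup>2 + k\<^sup>2) p)
                + of_int \<delta> * of_int (Legendre (j\<^sup>2 - k\<^sup>2) p)) = 0)"
  using det_interval_affine_Legendre det_interval_Legendre_squares by blast

end
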